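(* Let $\Gamma$ be a simplicial graph and $\mathcal{G}=\{G_u \mid u\in V(\Gamma)\}$ a collection of groups indexed by $V(\Gamma)$. If $w_1$ and $w_2$ are two graphically reduced words which are equal in the graph product $\Gamma\mathcal{G}$, then it is possible to transform $w_1$ into $w_2$ by (finitely many times) permuting two successive syllables which belong to adjacent vertex-groups.
   Context: The graph product $\Gamma\mathcal{G}$ is the quotient of the free product $\ast_{u\in V(\Gamma)}G_u$ by the normal subgroup generated by all commutators $[g,h]$ with $g\in G_u$, $h\in G_v$, $\{u,v\}\in E(\Gamma)$. The $G_u$ are called vertex-groups and are always assumed non-trivial. Two vertex-groups $G_u,G_v$ are adjacent if $\{u,v\}\in E(\Gamma)$. Let $w=s_1\cdots s_n$ be a word of length $n\geq 1$ written over $\bigcup_{u\in V(\Gamma)}G_u$; the $s_i$ are its syllables. The word $w$ is graphically reduced if: (i) either $n=1$ and $s_1=1$, or $s_i\neq 1$ for every $1\leq i\leq n$; and (ii) for every $1\leq i<j\leq n$, either $s_i$ and $s_j$ do not belong to the same vertex-group, or there exists some $i<k<j$ such that $s_k$ does not belong to a vertex-group adjacent to the common vertex-group containing $s_i$ and $s_j$. *)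

theory Defs
  imports "HOL-Algebra.Algebra"
begin

section \<open>Simplicial graphs\<close>

text \<open>A simplicial graph has neither loops nor multiple edges; it is allowed to be infinite.\<close>

definition simplicial_graph :: "'v set \<Rightarrow> 'v set set \<Rightarrow> bool" where
  "simplicial_graph V E \<longleftrightarrow> (\<forall>e\<in>E. \<exists>u\<in>V. \<exists>v\<in>V. u \<noteq> v \<and> e = {u, v})"


section \<open>Free products of families of groups\<close>

text \<open>
  The free product of the groups \<open>G u\<close> (\<open>u \<in> V\<close>) consists of the words over the disjoint union
  of the carriers, modulo the congruence generated by deleting a neutral letter and by multiplying
  two consecutive letters from the same group.
\<close>

definition letters :: "'v set \<Rightarrow> ('v \<Rightarrow> ('g, 'm) monoid_scheme) \<Rightarrow> ('v \<times> 'g) set" where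
  "letters V G = (SIGMA u:V. carrier (G u))"

inductive fp_step ::
    "'v set \<Rightarrow> ('v \<Rightarrow> ('g, 'm) monoid_scheme) \<Rightarrow> ('v \<times> 'g) list \<Rightarrow> ('v \<times> 'g) list \<Rightarrow> bool"
  for V G where
  one: "\<lbrakk>xs \<in> lists (letters V G); ys \<in> lists (letters V G); u \<in> V\<rbrakk>
    \<Longrightarrow> fp_step V G (xs @ [(u, \<one>\<^bsub>G u\<^esub>)] @ ys) (xs @ ys)"
| mult: "\<lbrakk>xs \<in> lists (letters V G); ys \<in> lists (letters V G); u \<in> V;
      g \<in> carrier (G u); h \<in> carrier (G u)\<rbrakk>
    \<Longrightarrow> fp_step V G (xs @ [(u, g), (u, h)] @ ys) (xs @ [(u, g \<otimes>\<^bsub>G u\<^esub> h)] @ ys)"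

definition fp_rel ::
    "'v set \<Rightarrow> ('v \<Rightarrow> ('g, 'm) monoid_scheme) \<Rightarrow> (('v \<times> 'g) list \<times> ('v \<times> 'g) list) set" where
  "fp_rel V G =
    {(xs, ys). xs \<in> lists (letters V G) \<and> ys \<in> lists (letters V G) \<and> equivclp (fp_step V G) xs ys}"

definition free_product ::
    "'v set \<Rightarrow> ('v \<Rightarrow> ('g, 'm) monoid_scheme) \<Rightarrow> ('v \<times> 'g) list set monoid" where
  "free_product V G =
    \<lparr>carrier = lists (letters V G) // fp_rel V G,
     monoid.mult = (\<lambda>A B. \<Union>xs\<in>A. \<Union>ys\<in>B. fp_rel V G `` {xs @ ys}),
     monoid.one = fp_rel V G `` {[]}\<rparr>"

definition vertex_embedding ::
    "'v set \<Rightarrow> ('v \<Rightarrow> ('g, 'm) monoid_scheme) \<Rightarrow> 'v \<Rightarrow> 'g \<Rightarrow> ('v \<times> 'g) list set" where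
  "vertex_embedding V G u g = fp_rel V G `` {[(u, g)]}"

text \<open>
  From here on, a vertex-group is regarded as a subgroup of the free product. In particular the
  vertex-groups have pairwise the same neutral element, and (as shown below) nothing else in common.
\<close>

definition vertex_group ::
    "'v set \<Rightarrow> ('v \<Rightarrow> ('g, 'm) monoid_scheme) \<Rightarrow> 'v \<Rightarrow> ('v \<times> 'g) list set set" where
  "vertex_group V G u = vertex_embedding V G u ` carrier (G u)"


section \<open>Graph products\<close>

definition normal_closure :: "('a, 'b) monoid_scheme \<Rightarrow> 'a set \<Rightarrow> 'a set" where
  "normal_closure F S = \<Inter>{N. N \<lhd> F \<and> S \<subseteq> N}"

definition edge_commutators ::
    "'v set \<Rightarrow> 'v set set \<Rightarrow> ('v \<Rightarrow> ('g, 'm) monoid_scheme) \<Rightarrow> ('v \<times> 'g) list set set" where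
  "edge_commutators V E G =
    {g \<otimes>\<^bsub>free_product V G\<^esub> h \<otimes>\<^bsub>free_product V G\<^esub> inv\<^bsub>free_product V G\<^esub> g
       \<otimes>\<^bsub>free_product V G\<^esub> inv\<^bsub>free_product V G\<^esub> h
     | g h u v. u \<in> V \<and> v \<in> V \<and> {u, v} \<in> E \<and> g \<in> vertex_group V G u \<and> h \<in> vertex_group V G v}"

definition graph_product_kernel ::
    "'v set \<Rightarrow> 'v set set \<Rightarrow> ('v \<Rightarrow> ('g, 'm) monoid_scheme) \<Rightarrow> ('v \<times> 'g) list set set" where
  "graph_product_kernel V E G = normal_closure (free_product V G) (edge_commutators V E G)"

definition graph_product ::
    "'v set \<Rightarrow> 'v set set \<Rightarrow> ('v \<Rightarrow> ('g, 'm) monoid_scheme) \<Rightarrow> ('v \<times> 'g) list set set monoid" where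
  "graph_product V E G = free_product V G Mod graph_product_kernel V E G"


section \<open>Words over the vertex-groups\<close>

text \<open>
  A word is a list over the union of the vertex-groups. Since this union is formed inside the free
  product, there is only one trivial syllable, which belongs to every vertex-group.
\<close>

definition word_value ::
    "'v set \<Rightarrow> 'v set set \<Rightarrow> ('v \<Rightarrow> ('g, 'm) monoid_scheme) \<Rightarrow> ('v \<times> 'g) list set list
      \<Rightarrow> ('v \<times> 'g) list set set" where
  "word_value V E G w =
    foldr (\<lambda>s x. (graph_product_kernel V E G #>\<^bsub>free_product V G\<^esub> s) \<otimes>\<^bsub>graph_product V E G\<^esub> x)
      w \<one>\<^bsub>graph_product V E G\<^esub>"

definition graphically_reduced ::
    "'v set \<Rightarrow> 'v set set \<Rightarrow> ('v \<Rightarrow> ('g, 'm) monoid_scheme) \<Rightarrow> ('v \<times> 'g) list set list \<Rightarrow> bool" where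
  "graphically_reduced V E G w \<longleftrightarrow>
    length w \<ge> 1 \<and>
    w \<in> lists (\<Union>u\<in>V. vertex_group V G u) \<and>
    ((length w = 1 \<and> w ! 0 = \<one>\<^bsub>free_product V G\<^esub>) \<or>
      (\<forall>i<length w. w ! i \<noteq> \<one>\<^bsub>free_product V G\<^esub>)) \<and>
    (\<forall>i j. i < j \<and> j < length w \<longrightarrow>
      (\<forall>u\<in>V. w ! i \<in> vertex_group V G u \<and> w ! j \<in> vertex_group V G u \<longrightarrow>
        (\<exists>k. i < k \<and> k < j \<and>
          \<not> (\<exists>v\<in>V. {u, v} \<in> E \<and> w ! k \<in> vertex_group V G v))))"

inductive syllable_swap ::
    "'v set \<Rightarrow> 'v set set \<Rightarrow> ('v \<Rightarrow> ('g, 'm) monoid_scheme)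
      \<Rightarrow> ('v \<times> 'g) list set list \<Rightarrow> ('v \<times> 'g) list set list \<Rightarrow> bool"
  for V E G where
  "\<lbrakk>u \<in> V; v \<in> V; {u, v} \<in> E; s \<in> vertex_group V G u; t \<in> vertex_group V G v\<rbrakk>
    \<Longrightarrow> syllable_swap V E G (xs @ [s, t] @ ys) (xs @ [t, s] @ ys)"


section \<open>Basic facts\<close>

lemma fp_step_append:
  assumes "fp_step V G x y" "a \<in> lists (letters V G)" "b \<in> lists (letters V G)"
  shows "fp_step V G (a @ x @ b) (a @ y @ b)"
  using assms(1)
proof cases
  case (one xs ys u)
  then show ?thesis using assms fp_step.one[of "a @ xs" V G "ys @ b" u] by auto
next
  case (mult xs ys u g h)
  then show ?thesis using assms fp_step.mult[of "a @ xs" V G "ys @ b" u g h] by auto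
qed

lemma fp_equiv_append:
  assumes "equivclp (fp_step V G) x y" "a \<in> lists (letters V G)" "b \<in> lists (letters V G)"
  shows "equivclp (fp_step V G) (a @ x @ b) (a @ y @ b)"
  using assms(1)
proof (induction rule: equivclp_induct)
  case base
  show ?case by simp
next
  case (step y z)
  have "equivclp (fp_step V G) (a @ y @ b) (a @ z @ b)"
    using step(2) fp_step_append[OF _ assms(2,3)]
    by (metis r_into_equivclp equivclp_sym)
  then show ?case using step(3) equivclp_trans by metis
qed

lemma equiv_fp_rel: "equiv (lists (letters V G)) (fp_rel V G)"
proof (rule equivI)
  show "sym (fp_rel V G)"
    by (auto simp: fp_rel_def sym_def dest: equivclp_sym)
  show "trans (fp_rel V G)"
  proof (rule transI)
    fix x y z assume "(x, y) \<in> fp_rel V G" "(y, z) \<in> fp_rel V G"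
    then show "(x, z) \<in> fp_rel V G"
      using equivclp_trans[of "fp_step V G" x y z] by (simp add: fp_rel_def)
  qed
qed (auto simp: fp_rel_def refl_on_def)

lemma fp_mult_class:
  assumes "x \<in> lists (letters V G)" "y \<in> lists (letters V G)"
  shows "fp_rel V G `` {x} \<otimes>\<^bsub>free_product V G\<^esub> fp_rel V G `` {y} = fp_rel V G `` {x @ y}"
proof -
  have eq: "fp_rel V G `` {x' @ y'} = fp_rel V G `` {x @ y}"
    if "(x, x') \<in> fp_rel V G" "(y, y') \<in> fp_rel V G" for x' y'
  proof -
    have "equivclp (fp_step V G) (x @ y) (x' @ y)" "equivclp (fp_step V G) (x' @ y) (x' @ y')"
      using that fp_equiv_append[of V G x x' "[]" y] fp_equiv_append[of V G y y' x' "[]"]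
      by (auto simp: fp_rel_def)
    then have "(x @ y, x' @ y') \<in> fp_rel V G"
      using that assms equivclp_trans[of "fp_step V G" "x @ y" "x' @ y" "x' @ y'"]
      by (simp add: fp_rel_def)
    then show ?thesis using equiv_class_eq[OF equiv_fp_rel] by metis
  qed
  have "(x, x) \<in> fp_rel V G" "(y, y) \<in> fp_rel V G"
    using assms by (auto simp: fp_rel_def)
  then have ne: "fp_rel V G `` {x} \<noteq> {}" "fp_rel V G `` {y} \<noteq> {}"
    by blast+
  have "(\<Union>x'\<in>fp_rel V G `` {x}. \<Union>y'\<in>fp_rel V G `` {y}. fp_rel V G `` {x' @ y'}) =
      (\<Union>x'\<in>fp_rel V G `` {x}. \<Union>y'\<in>fp_rel V G `` {y}. fp_rel V G `` {x @ y})"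
    by (intro SUP_cong refl eq) (simp_all only: Image_singleton_iff)
  also have "\<dots> = fp_rel V G `` {x @ y}"
    by (simp only: UN_constant ne if_False)
  finally show ?thesis by (simp add: free_product_def)
qed

lemma fp_class_in_carrier:
  "x \<in> lists (letters V G) \<Longrightarrow> fp_rel V G `` {x} \<in> carrier (free_product V G)"
  by (simp add: free_product_def quotientI)

lemma fp_carrierE:
  assumes "A \<in> carrier (free_product V G)"
  obtains x where "x \<in> lists (letters V G)" "A = fp_rel V G `` {x}"
proof -
  have "A \<in> lists (letters V G) // fp_rel V G" using assms by (simp add: free_product_def)
  then show ?thesis by (rule quotientE) (rule that)
qed

lemma fp_one: "\<one>\<^bsub>free_product V G\<^esub> = fp_rel V G `` {[]}"
  by (simp add: free_product_def)

lemma fp_class_eq: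
  assumes "equivclp (fp_step V G) x y" "x \<in> lists (letters V G)" "y \<in> lists (letters V G)"
  shows "fp_rel V G `` {x} = fp_rel V G `` {y}"
proof (rule equiv_class_eq[OF equiv_fp_rel])
  show "(x, y) \<in> fp_rel V G" using assms by (simp add: fp_rel_def)
qed

lemma fp_left_inverse:
  assumes "\<And>u. u \<in> V \<Longrightarrow> group (G u)" "x \<in> lists (letters V G)"
  shows "\<exists>y \<in> lists (letters V G). equivclp (fp_step V G) (y @ x) []"
  using assms(2)
proof (induction x)
  case Nil
  then show ?case by (intro bexI[of _ "[]"]) auto
next
  case (Cons a x)
  then obtain y where y: "y \<in> lists (letters V G)" "equivclp (fp_step V G) (y @ x) []"
    by auto
  obtain u g where a: "a = (u, g)" "u \<in> V" "g \<in> carrier (G u)"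
    using Cons by (auto simp: letters_def)
  interpret group "G u" using assms(1) a(2) by simp
  have x: "x \<in> lists (letters V G)" using Cons by auto
  have "fp_step V G ((y @ [(u, inv\<^bsub>G u\<^esub> g)]) @ (a # x)) (y @ [(u, \<one>\<^bsub>G u\<^esub>)] @ x)"
    using fp_step.mult[OF y(1) x a(2), of "inv\<^bsub>G u\<^esub> g" g] a by simp
  moreover have "fp_step V G (y @ [(u, \<one>\<^bsub>G u\<^esub>)] @ x) (y @ x)"
    using fp_step.one[OF y(1) x a(2)] .
  ultimately have "equivclp (fp_step V G) ((y @ [(u, inv\<^bsub>G u\<^esub> g)]) @ (a # x)) []"
    using y(2) by (metis equivclp_trans r_into_equivclp)
  moreover have "y @ [(u, inv\<^bsub>G u\<^esub> g)] \<in> lists (letters V G)"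
    using y a by (auto simp: letters_def)
  ultimately show ?case by blast
qed

lemma group_free_product:
  assumes "\<And>u. u \<in> V \<Longrightarrow> group (G u)"
  shows "group (free_product V G)"
proof (rule groupI)
  fix A B assume "A \<in> carrier (free_product V G)" "B \<in> carrier (free_product V G)"
  then show "A \<otimes>\<^bsub>free_product V G\<^esub> B \<in> carrier (free_product V G)"
    by (elim fp_carrierE) (auto simp: fp_mult_class intro!: fp_class_in_carrier)
next
  show "\<one>\<^bsub>free_product V G\<^esub> \<in> carrier (free_product V G)"
    unfolding fp_one by (rule fp_class_in_carrier) simp
next
  fix A B C
  assume "A \<in> carrier (free_product V G)" "B \<in> carrier (free_product V G)"
    "C \<in> carrier (free_product V G)"
  then show "A \<otimes>\<^bsub>free_product V G\<^esub> B \<otimes>\<^bsub>free_product V G\<^esub> C =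
      A \<otimes>\<^bsub>free_product V G\<^esub> (B \<otimes>\<^bsub>free_product V G\<^esub> C)"
    by (elim fp_carrierE) (simp add: fp_mult_class)
next
  fix A assume "A \<in> carrier (free_product V G)"
  then show "\<one>\<^bsub>free_product V G\<^esub> \<otimes>\<^bsub>free_product V G\<^esub> A = A"
    unfolding fp_one by (elim fp_carrierE) (simp add: fp_mult_class)
next
  fix A assume "A \<in> carrier (free_product V G)"
  then obtain x where x: "x \<in> lists (letters V G)" "A = fp_rel V G `` {x}" by (elim fp_carrierE)
  obtain y where y: "y \<in> lists (letters V G)" "equivclp (fp_step V G) (y @ x) []"
    using fp_left_inverse[OF assms x(1)] by auto
  have "fp_rel V G `` {y} \<otimes>\<^bsub>free_product V G\<^esub> A = \<one>\<^bsub>free_product V G\<^esub>"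
    unfolding x(2) fp_one fp_mult_class[OF y(1) x(1)]
    using x y by (intro fp_class_eq) auto
  then show "\<exists>B\<in>carrier (free_product V G). B \<otimes>\<^bsub>free_product V G\<^esub> A = \<one>\<^bsub>free_product V G\<^esub>"
    using fp_class_in_carrier[OF y(1)] by blast
qed

lemma vertex_embedding_hom:
  assumes "u \<in> V" "group (G u)"
  shows "vertex_embedding V G u \<in> hom (G u) (free_product V G)"
proof (rule homI)
  fix g assume "g \<in> carrier (G u)"
  then show "vertex_embedding V G u g \<in> carrier (free_product V G)"
    using assms unfolding vertex_embedding_def
    by (intro fp_class_in_carrier) (auto simp: letters_def)
next
  interpret group "G u" by fact
  fix g h assume gh: "g \<in> carrier (G u)" "h \<in> carrier (G u)"
  then have l: "[(u, g)] \<in> lists (letters V G)" "[(u, h)] \<in> lists (letters V G)"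
    "[(u, g \<otimes>\<^bsub>G u\<^esub> h)] \<in> lists (letters V G)"
    using assms by (auto simp: letters_def)
  have "fp_step V G [(u, g), (u, h)] [(u, g \<otimes>\<^bsub>G u\<^esub> h)]"
    using fp_step.mult[of "[]" V G "[]" u g h] assms gh by simp
  then show "vertex_embedding V G u (g \<otimes>\<^bsub>G u\<^esub> h) =
      vertex_embedding V G u g \<otimes>\<^bsub>free_product V G\<^esub> vertex_embedding V G u h"
    unfolding vertex_embedding_def fp_mult_class[OF l(1,2)]
    using l by (intro fp_class_eq equivclp_sym[OF r_into_equivclp]) auto
qed

text \<open>The image of a word under the retraction of the free product onto the factor \<open>G u\<close>.\<close>

definition fp_retract :: "('v \<Rightarrow> ('g, 'm) monoid_scheme) \<Rightarrow> 'v \<Rightarrow> ('v \<times> 'g) list \<Rightarrow> 'g" where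
  "fp_retract G u x = foldr (\<lambda>(v, g) y. if v = u then g \<otimes>\<^bsub>G u\<^esub> y else y) x \<one>\<^bsub>G u\<^esub>"

lemma fp_retract_closed:
  assumes "group (G u)" "x \<in> lists (letters V G)"
  shows "fp_retract G u x \<in> carrier (G u)"
proof -
  interpret group "G u" by fact
  show ?thesis
    using assms(2) by (induction x) (auto simp: fp_retract_def letters_def)
qed

lemma fp_retract_append:
  assumes "group (G u)" "x \<in> lists (letters V G)" "y \<in> lists (letters V G)"
  shows "fp_retract G u (x @ y) = fp_retract G u x \<otimes>\<^bsub>G u\<^esub> fp_retract G u y"
proof -
  interpret group "G u" by fact
  show ?thesis
    using assms(2)
  proof (induction x)
    case Nil
    then show ?case using fp_retract_closed[of G u, OF assms(1,3)] by (simp add: fp_retract_def)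
  next
    case (Cons a x)
    obtain v g where a: "a = (v, g)" "g \<in> carrier (G v)"
      using Cons by (auto simp: letters_def)
    have "fp_retract G u x \<in> carrier (G u)" "fp_retract G u y \<in> carrier (G u)"
      using fp_retract_closed[of G u, OF assms(1)] assms(3) Cons by auto
    then show ?case using Cons a by (auto simp: fp_retract_def m_assoc)
  qed
qed

lemma fp_retract_step:
  assumes "group (G u)" "fp_step V G x y"
  shows "fp_retract G u x = fp_retract G u y"
proof -
  interpret group "G u" by fact
  show ?thesis
    using assms(2)
  proof cases
    case (one xs ys v)
    have "fp_retract G u ([(v, \<one>\<^bsub>G v\<^esub>)] @ ys) = fp_retract G u ys"
      using fp_retract_closed[of G u, OF assms(1) one(4)] by (auto simp: fp_retract_def)
    then show ?thesis unfolding one(1,2) by (simp add: fp_retract_def)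
  next
    case (mult xs ys v g h)
    have "fp_retract G u ([(v, g), (v, h)] @ ys) = fp_retract G u ([(v, g \<otimes>\<^bsub>G v\<^esub> h)] @ ys)"
      using fp_retract_closed[of G u, OF assms(1) mult(4)] mult(6,7)
      by (auto simp: fp_retract_def m_assoc)
    then show ?thesis unfolding mult(1,2) by (simp add: fp_retract_def)
  qed
qed

lemma fp_retract_equiv:
  assumes "group (G u)" "equivclp (fp_step V G) x y"
  shows "fp_retract G u x = fp_retract G u y"
  using assms(2)
  by (induction rule: equivclp_induct) (auto dest: fp_retract_step[of G u, OF assms(1)])

lemma vertex_embedding_eqD:
  assumes "u \<in> V" "group (G u)" "g \<in> carrier (G u)" "v \<in> V" "h \<in> carrier (G v)"
    and "vertex_embedding V G u g = vertex_embedding V G v h"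
  shows "if u = v then g = h else g = \<one>\<^bsub>G u\<^esub>"
proof -
  interpret group "G u" by fact
  have "[(u, g)] \<in> lists (letters V G)" "[(v, h)] \<in> lists (letters V G)"
    using assms by (auto simp: letters_def)
  then have "equivclp (fp_step V G) [(u, g)] [(v, h)]"
    using assms(6) eq_equiv_class_iff[OF equiv_fp_rel]
    by (auto simp: vertex_embedding_def fp_rel_def)
  from fp_retract_equiv[of G u, OF assms(2) this] show ?thesis
    using assms(3,5) by (auto simp: fp_retract_def split: if_splits)
qed

lemma inj_on_vertex_embedding:
  assumes "u \<in> V" "group (G u)"
  shows "inj_on (vertex_embedding V G u) (carrier (G u))"
  using vertex_embedding_eqD[of u V G, OF assms _ assms(1)] by (auto simp: inj_on_def)

lemma vertex_group_Int:
  assumes "\<And>u. u \<in> V \<Longrightarrow> group (G u)" "u \<in> V" "v \<in> V" "u \<noteq> v"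
  shows "vertex_group V G u \<inter> vertex_group V G v = {\<one>\<^bsub>free_product V G\<^esub>}"
proof -
  have one: "vertex_embedding V G w \<one>\<^bsub>G w\<^esub> = \<one>\<^bsub>free_product V G\<^esub>" if "w \<in> V" for w
    using hom_one[of _ "G w" "free_product V G"] vertex_embedding_hom[of w V G]
      group_free_product[of V G] assms(1) that by blast
  have "\<one>\<^bsub>free_product V G\<^esub> \<in> vertex_group V G w" if "w \<in> V" for w
    using one[OF that] group.is_monoid[OF assms(1)[OF that]] monoid.one_closed
    unfolding vertex_group_def by (metis imageI)
  moreover have "x = \<one>\<^bsub>free_product V G\<^esub>" if x: "x \<in> vertex_group V G u" "x \<in> vertex_group V G v" for x
  proof -
    obtain g h where "g \<in> carrier (G u)" "h \<in> carrier (G v)"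
      "x = vertex_embedding V G u g" "x = vertex_embedding V G v h"
      using x unfolding vertex_group_def by blast
    then show ?thesis
      using vertex_embedding_eqD[of u V G g v h, OF assms(2) assms(1)[OF assms(2)]] assms(3,4) one[OF assms(2)]
      by auto
  qed
  ultimately show ?thesis using assms(2,3) by blast
qed

lemma edge_commutators_closed:
  assumes "\<And>u. u \<in> V \<Longrightarrow> group (G u)"
  shows "edge_commutators V E G \<subseteq> carrier (free_product V G)"
proof -
  interpret F: group "free_product V G" using group_free_product assms by blast
  have "vertex_group V G u \<subseteq> carrier (free_product V G)" if "u \<in> V" for u
    using vertex_embedding_hom[of u V G, OF that assms[OF that]] by (auto simp: vertex_group_def hom_def)
  then show ?thesis by (fastforce simp: edge_commutators_def)
qed

lemma (in group) normal_normal_closure: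
  assumes "S \<subseteq> carrier G"
  shows "normal_closure G S \<lhd> G"
proof -
  have "carrier G \<lhd> G" by (rule normal_invI) (auto simp: subgroup_self)
  then have ne: "{N. N \<lhd> G \<and> S \<subseteq> N} \<noteq> {}" using assms by blast
  show ?thesis unfolding normal_closure_def
  proof (rule normal_invI)
    show "subgroup (\<Inter>{N. N \<lhd> G \<and> S \<subseteq> N}) G"
      using ne by (intro subgroups_Inter) (auto intro: normal_imp_subgroup)
  qed (auto intro: normal.inv_op_closed2)
qed

lemma group_graph_product:
  assumes "\<And>u. u \<in> V \<Longrightarrow> group (G u)"
  shows "group (graph_product V E G)"
proof -
  interpret F: group "free_product V G" using group_free_product assms by blast
  have "edge_commutators V E G \<subseteq> carrier (free_product V G)"
    using edge_commutators_closed assms by blast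
  from normal.factorgroup_is_group[OF F.normal_normal_closure[OF this]]
  show ?thesis unfolding graph_product_def graph_product_kernel_def .
qed

end

theory Submission
  imports Defs
begin

text \<open>
  The proof lets the free product act on reduced words, in the manner of van der Waerden's proof of
  the normal form theorem for free products. A word is encoded by its letters \<open>(u, g)\<close>, and
  \<open>\<sim>\<^sub>s\<close> denotes equality up to exchanging neighbouring letters over adjacent vertices.
  A letter \<open>(u, g)\<close> acts on a reduced word \<open>w\<close> as follows: if some letter \<open>(u, h)\<close> of \<open>w\<close> can be
  shuffled to the front, it is extracted and replaced by \<open>(u, g h)\<close> in front of the word, which is
  dropped when \<open>g h = 1\<close>; otherwise \<open>(u, g)\<close> is put in front of \<open>w\<close>, unless \<open>g = 1\<close>.

  Modulo \<open>\<sim>\<^sub>s\<close> this respects multiplication in each vertex-group (\<open>act_one\<close>, \<open>act_mult\<close>), so the free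
  product acts, and letters over adjacent vertices act by commuting maps (\<open>act_commute\<close>), so the
  edge commutators act trivially. The elements that act trivially form a normal subgroup; hence it
  contains the whole kernel of the projection to the graph product, and the graph product acts.

  A reduced word, applied letter by letter to the empty word, gives back itself, because no merging
  ever takes place (\<open>act_word_Nil\<close>). So two reduced words with the same value in the graph product
  send the empty word to words related by \<open>\<sim>\<^sub>s\<close>, that is, they are themselves related by \<open>\<sim>\<^sub>s\<close>
  (\<open>reduced_unique\<close>). What remains is the translation between letters and syllables. In it, the
  one-syllable word \<open>1\<close> corresponds to the empty word of letters; as \<open>\<sim>\<^sub>s\<close> preserves length, it
  equals no other reduced word.
\<close>

section \<open>Words of letters up to exchanges\<close>

locale graph_of_groups =
  fixes V :: "'v set" and E :: "'v set set" and G :: "'v \<Rightarrow> ('g, 'm) monoid_scheme"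
  assumes simplicial: "simplicial_graph V E"
    and groups: "\<And>u. u \<in> V \<Longrightarrow> group (G u)"
begin

lemma edge_neq: "{u, v} \<in> E \<Longrightarrow> u \<noteq> v"
  using simplicial unfolding simplicial_graph_def by (fastforce simp: doubleton_eq_iff)

inductive swap :: "('v \<times> 'g) list \<Rightarrow> ('v \<times> 'g) list \<Rightarrow> bool" where
  here: "{u, v} \<in> E \<Longrightarrow> swap ((u, g) # (v, h) # w) ((v, h) # (u, g) # w)"
| later: "swap w w' \<Longrightarrow> swap (a # w) (a # w')"

abbreviation swap_equiv :: "('v \<times> 'g) list \<Rightarrow> ('v \<times> 'g) list \<Rightarrow> bool" (infix "\<sim>\<^sub>s" 50) where
  "w \<sim>\<^sub>s w' \<equiv> swap\<^sup>*\<^sup>* w w'"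

lemma swap_sym: "swap w w' \<Longrightarrow> swap w' w"
  by (induction rule: swap.induct) (auto intro: swap.intros simp: insert_commute)

lemma swap_equiv_sym: "w \<sim>\<^sub>s w' \<Longrightarrow> w' \<sim>\<^sub>s w"
  by (rule sympD[OF symp_rtranclp]) (auto intro: sympI swap_sym)

lemma swap_equiv_Cons: "w \<sim>\<^sub>s w' \<Longrightarrow> a # w \<sim>\<^sub>s a # w'"
proof (induction rule: rtranclp_induct)
  case (step y z)
  then show ?case by (blast intro: rtranclp.rtrancl_into_rtrancl later)
qed simp

lemma swap_equiv_length: "w \<sim>\<^sub>s w' \<Longrightarrow> length w = length w'"
proof (induction rule: rtranclp_induct)
  case (step y z)
  from step(2) have "length y = length z" by (induction rule: swap.induct) auto
  then show ?case using step by simp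
qed simp

section \<open>Extracting the front letter of a vertex-group\<close>

text \<open>
  The two functions below find the first letter over \<open>u\<close> that is preceded only by letters over
  neighbours of \<open>u\<close>: \<open>front\<close> returns its group element and \<open>strip\<close> deletes it. If there is no such
  letter, \<open>front\<close> returns the neutral element and \<open>strip\<close> deletes nothing, so that in the absence of
  trivial letters \<open>front u w = 1\<close> means that no letter over \<open>u\<close> can be shuffled to the front.
\<close>

fun front :: "'v \<Rightarrow> ('v \<times> 'g) list \<Rightarrow> 'g" where
  "front u [] = \<one>\<^bsub>G u\<^esub>"
| "front u ((v, g) # w) =
    (if v = u then g else if {u, v} \<in> E then front u w else \<one>\<^bsub>G u\<^esub>)"

fun strip :: "'v \<Rightarrow> ('v \<times> 'g) list \<Rightarrow> ('v \<times> 'g) list" where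
  "strip u [] = []"
| "strip u ((v, g) # w) =
    (if v = u then w else if {u, v} \<in> E then (v, g) # strip u w else (v, g) # w)"

text \<open>
  Each letter is required to meet no letter over its own vertex that can be shuffled next to it;
  phrased through \<open>front\<close>, this becomes a recursion on the word.
\<close>

fun reduced :: "('v \<times> 'g) list \<Rightarrow> bool" where
  "reduced [] \<longleftrightarrow> True"
| "reduced ((u, g) # w) \<longleftrightarrow>
    u \<in> V \<and> g \<in> carrier (G u) \<and> g \<noteq> \<one>\<^bsub>G u\<^esub> \<and> front u w = \<one>\<^bsub>G u\<^esub> \<and> reduced w"

lemma reduced_letters: "reduced w \<Longrightarrow> w \<in> lists (letters V G)"
  by (induction w rule: reduced.induct) (auto simp: letters_def)

lemma front_closed: "reduced w \<Longrightarrow> u \<in> V \<Longrightarrow> front u w \<in> carrier (G u)"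
  by (induction w rule: reduced.induct) (auto simp: groups group.is_monoid)

lemma front_swap: "swap w w' \<Longrightarrow> front u w = front u w'"
  by (induction rule: swap.induct) (auto simp: insert_commute dest: edge_neq split: prod.splits)

lemma strip_swap: "swap w w' \<Longrightarrow> strip u w \<sim>\<^sub>s strip u w'"
proof (induction rule: swap.induct)
  case (here p q g h w)
  then show ?case
    using swap.here[OF here, of g h] by (auto simp: insert_commute dest: edge_neq)
next
  case (later w w' a)
  then show ?case by (cases a) (auto intro: swap_equiv_Cons swap.later)
qed

lemma reduced_swap: "swap w w' \<Longrightarrow> reduced w \<Longrightarrow> reduced w'"
proof (induction rule: swap.induct)
  case (here p q g h w)
  then show ?case by (auto simp: insert_commute dest: edge_neq)
next
  case (later w w' a)
  then show ?case by (cases a) (auto simp: front_swap)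
qed

lemma front_swap_equiv: "w \<sim>\<^sub>s w' \<Longrightarrow> front u w = front u w'"
  by (induction rule: rtranclp_induct) (auto dest: front_swap)

lemma strip_swap_equiv: "w \<sim>\<^sub>s w' \<Longrightarrow> strip u w \<sim>\<^sub>s strip u w'"
proof (induction rule: rtranclp_induct)
  case (step y z)
  then show ?case using strip_swap[of y z u] by (blast intro: rtranclp_trans)
qed simp

lemma reduced_swap_equiv: "w \<sim>\<^sub>s w' \<Longrightarrow> reduced w \<Longrightarrow> reduced w'"
  by (induction rule: rtranclp_induct) (auto dest: reduced_swap)

lemma front_strip_same: "reduced w \<Longrightarrow> front u (strip u w) = \<one>\<^bsub>G u\<^esub>"
  by (induction w rule: reduced.induct) auto

lemma strip_eq_self: "reduced w \<Longrightarrow> front u w = \<one>\<^bsub>G u\<^esub> \<Longrightarrow> strip u w = w"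
  by (induction w rule: reduced.induct) (auto split: if_splits)

text \<open>
  A letter over \<open>u\<close> never obstructs the search for a letter over a neighbour \<open>v\<close>, so deleting it
  does not change what the search finds.
\<close>

lemma front_strip_adjacent:
  assumes "{u, v} \<in> E"
  shows "front v (strip u w) = front v w"
  using assms edge_neq[OF assms]
  by (induction w rule: reduced.induct) (auto simp: insert_commute)

lemma strip_commute:
  assumes "{u, v} \<in> E"
  shows "strip u (strip v w) = strip v (strip u w)"
  using assms edge_neq[OF assms]
  by (induction w rule: reduced.induct) (auto simp: insert_commute)

lemma reduced_strip: "reduced w \<Longrightarrow> reduced (strip u w)"
  by (induction w rule: reduced.induct) (auto simp: front_strip_adjacent)

section \<open>The action of a vertex-group\<close>

definition push :: "'v \<Rightarrow> 'g \<Rightarrow> ('v \<times> 'g) list \<Rightarrow> ('v \<times> 'g) list" where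
  "push u g w = (if g = \<one>\<^bsub>G u\<^esub> then w else (u, g) # w)"

text \<open>
  The extracted letter commutes with everything that stood before it, so putting it back in front
  of the word only costs exchanges.
\<close>

lemma push_front_strip: "reduced w \<Longrightarrow> push u (front u w) (strip u w) \<sim>\<^sub>s w"
proof (induction w rule: reduced.induct)
  case (2 v g w)
  show ?case
  proof (cases "{u, v} \<in> E \<and> front u w \<noteq> \<one>\<^bsub>G u\<^esub>")
    case True
    then have "push u (front u ((v, g) # w)) (strip u ((v, g) # w)) =
        (u, front u w) # (v, g) # strip u w"
      using edge_neq[of u v] by (auto simp: push_def)
    also have "\<dots> \<sim>\<^sub>s (v, g) # (u, front u w) # strip u w"
      using True by (blast intro: here)
    also have "\<dots> \<sim>\<^sub>s (v, g) # w"
      using 2 True by (auto simp: push_def intro: swap_equiv_Cons)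
    finally show ?thesis .
  next
    case False
    then show ?thesis using 2 by (auto simp: push_def strip_eq_self)
  qed
qed (simp add: push_def)

definition act :: "'v \<Rightarrow> 'g \<Rightarrow> ('v \<times> 'g) list \<Rightarrow> ('v \<times> 'g) list" where
  "act u g w = push u (g \<otimes>\<^bsub>G u\<^esub> front u w) (strip u w)"

lemma act_swap_equiv: "w \<sim>\<^sub>s w' \<Longrightarrow> act u g w \<sim>\<^sub>s act u g w'"
  by (auto simp: act_def push_def front_swap_equiv intro: swap_equiv_Cons strip_swap_equiv)

lemma mult_front_closed:
  "u \<in> V \<Longrightarrow> g \<in> carrier (G u) \<Longrightarrow> reduced w \<Longrightarrow> g \<otimes>\<^bsub>G u\<^esub> front u w \<in> carrier (G u)"
  by (simp add: front_closed groups group.is_monoid monoid.m_closed)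

lemma reduced_act:
  assumes "u \<in> V" "g \<in> carrier (G u)" "reduced w"
  shows "reduced (act u g w)"
  using assms mult_front_closed[OF assms]
  by (auto simp: act_def push_def reduced_strip front_strip_same)

lemma act_one:
  assumes "u \<in> V" "reduced w"
  shows "act u \<one>\<^bsub>G u\<^esub> w \<sim>\<^sub>s w"
  using assms push_front_strip[of w u]
  by (simp add: act_def front_closed groups group.is_monoid monoid.l_one)

text \<open>
  After \<open>(u, h)\<close> has acted, all of the \<open>u\<close>-part of the word is concentrated in its front letter,
  which is \<open>h\<close> times the old one (and absent if that is trivial), and the stripped word is still \<open>strip u w\<close>. Thus both sides
  push the same element onto the same word.
\<close>

lemma act_mult:
  assumes "u \<in> V" "g \<in> carrier (G u)" "h \<in> carrier (G u)" "reduced w"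
  shows "act u g (act u h w) = act u (g \<otimes>\<^bsub>G u\<^esub> h) w"
proof -
  interpret group "G u" using assms(1) by (rule groups)
  have "front u (act u h w) = h \<otimes>\<^bsub>G u\<^esub> front u w" "strip u (act u h w) = strip u w"
    using assms reduced_strip[of w u]
    by (auto simp: act_def push_def front_strip_same strip_eq_self)
  then show ?thesis
    using assms by (simp add: act_def m_assoc front_closed)
qed

text \<open>
  Both sides consist of a letter over \<open>u\<close> and a letter over \<open>v\<close>, each possibly absent, in front of
  the word with both front letters deleted; neither extraction notices the other. The order of
  the two new letters is the only difference.
\<close>

lemma act_commute:
  assumes "{u, v} \<in> E"
  shows "act u g (act v h w) \<sim>\<^sub>s act v h (act u g w)"
proof -
  have vu: "{v, u} \<in> E" using assms by (simp add: insert_commute)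
  have "front u (act v h w) = front u w" "front v (act u g w) = front v w"
    "strip u (act v h w) = push v (h \<otimes>\<^bsub>G v\<^esub> front v w) (strip u (strip v w))"
    "strip v (act u g w) = push u (g \<otimes>\<^bsub>G u\<^esub> front u w) (strip u (strip v w))"
    using assms vu edge_neq[OF assms] strip_commute[OF assms, of w]
    by (auto simp: act_def push_def front_strip_adjacent)
  then show ?thesis
    using here[OF assms] by (auto simp: act_def[of u g "act v h w"] act_def[of v h "act u g w"] push_def)
qed

section \<open>The action of the free product\<close>

definition act_word :: "('v \<times> 'g) list \<Rightarrow> ('v \<times> 'g) list \<Rightarrow> ('v \<times> 'g) list" where
  "act_word x w = foldr (\<lambda>(u, g). act u g) x w"

lemma act_word_simps [simp]:
  "act_word [] w = w"
  "act_word ((u, g) # x) w = act u g (act_word x w)"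
  "act_word (x @ y) w = act_word x (act_word y w)"
  by (simp_all add: act_word_def)

lemma act_word_swap_equiv: "w \<sim>\<^sub>s w' \<Longrightarrow> act_word x w \<sim>\<^sub>s act_word x w'"
  by (induction x) (auto intro: act_swap_equiv)

lemma reduced_act_word: "x \<in> lists (letters V G) \<Longrightarrow> reduced w \<Longrightarrow> reduced (act_word x w)"
  by (induction x) (auto simp: letters_def intro: reduced_act)

text \<open>
  Acting from the right end, every letter meets a suffix of a reduced word, whose front at the same
  vertex is trivial; so it is put in front without merging.
\<close>

lemma act_word_Nil: "reduced x \<Longrightarrow> act_word x [] = x"
proof (induction x rule: reduced.induct)
  case (2 u g x)
  interpret group "G u" using 2 groups by simp
  show ?case using 2 by (simp add: act_def push_def strip_eq_self)
qed simp

lemma act_word_fp_step: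
  assumes "fp_step V G x y" "reduced w"
  shows "act_word x w \<sim>\<^sub>s act_word y w"
  using assms(1)
proof cases
  case (one xs ys u)
  then show ?thesis
    using assms(2) by (auto intro!: act_word_swap_equiv act_one reduced_act_word)
next
  case (mult xs ys u g h)
  then show ?thesis
    using assms(2) by (simp add: act_mult reduced_act_word)
qed

lemma act_word_equivclp:
  assumes "equivclp (fp_step V G) x y" "reduced w"
  shows "act_word x w \<sim>\<^sub>s act_word y w"
  using assms(1)
proof (induction rule: equivclp_induct)
  case (step y z)
  then have "act_word y w \<sim>\<^sub>s act_word z w"
    using act_word_fp_step[OF _ assms(2)] swap_equiv_sym by blast
  then show ?case using step by simp
qed simp

abbreviation F :: "('v \<times> 'g) list set monoid" where "F \<equiv> free_product V G"

abbreviation cls :: "('v \<times> 'g) list \<Rightarrow> ('v \<times> 'g) list set" where "cls x \<equiv> fp_rel V G `` {x}"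

lemma group_F: "group F"
  by (rule group_free_product) (rule groups)

lemma act_word_cls_eq:
  assumes "cls x = cls y" "x \<in> lists (letters V G)" "y \<in> lists (letters V G)" "reduced w"
  shows "act_word x w \<sim>\<^sub>s act_word y w"
  using assms act_word_equivclp eq_equiv_class_iff[OF equiv_fp_rel assms(2,3)]
  by (auto simp: fp_rel_def)

text \<open>
  By \<open>act_word_cls_eq\<close>, the effect modulo \<open>\<sim>\<^sub>s\<close> does not depend on the chosen representative \<open>x\<close>.
\<close>

definition acting_trivially :: "('v \<times> 'g) list set set" where
  "acting_trivially = {cls x | x. x \<in> lists (letters V G) \<and> (\<forall>w. reduced w \<longrightarrow> act_word x w \<sim>\<^sub>s w)}"

lemma cls_acting_trivially:
  assumes "x \<in> lists (letters V G)"
  shows "cls x \<in> acting_trivially \<longleftrightarrow> (\<forall>w. reduced w \<longrightarrow> act_word x w \<sim>\<^sub>s w)"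
proof
  assume "cls x \<in> acting_trivially"
  then obtain y where y: "cls x = cls y" "y \<in> lists (letters V G)"
    "\<And>w. reduced w \<Longrightarrow> act_word y w \<sim>\<^sub>s w"
    unfolding acting_trivially_def by blast
  show "\<forall>w. reduced w \<longrightarrow> act_word x w \<sim>\<^sub>s w"
    using act_word_cls_eq[OF y(1) assms y(2)] y(3) by (blast intro: rtranclp_trans)
qed (use assms in \<open>auto simp: acting_trivially_def\<close>)

text \<open>
  Inverses are represented by an otherwise unspecified word \<open>y\<close>; all that is used about it is that
  it undoes the action of \<open>x\<close>.
\<close>

lemma inv_cls:
  assumes "x \<in> lists (letters V G)"
  obtains y where "y \<in> lists (letters V G)" "inv\<^bsub>F\<^esub> cls x = cls y"
    "\<And>w. reduced w \<Longrightarrow> act_word x (act_word y w) \<sim>\<^sub>s w"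
    "\<And>w. reduced w \<Longrightarrow> act_word y (act_word x w) \<sim>\<^sub>s w"
proof -
  interpret F: group F by (rule group_F)
  have x: "cls x \<in> carrier F" using assms by (rule fp_class_in_carrier)
  then obtain y where y: "y \<in> lists (letters V G)" "inv\<^bsub>F\<^esub> cls x = cls y"
    using fp_carrierE F.inv_closed by metis
  have "cls (x @ y) = cls []" "cls (y @ x) = cls []"
    using F.r_inv[OF x] F.l_inv[OF x] y assms by (simp_all add: fp_mult_class fp_one)
  then have "act_word (x @ y) w \<sim>\<^sub>s act_word [] w" "act_word (y @ x) w \<sim>\<^sub>s act_word [] w"
    if "reduced w" for w
    using that assms y(1) act_word_cls_eq[of "x @ y" "[]" w] act_word_cls_eq[of "y @ x" "[]" w]
    by auto
  then show thesis using that y by simp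
qed

lemma acting_trivially_normal: "acting_trivially \<lhd> F"
proof -
  interpret F: group F by (rule group_F)
  show ?thesis
  proof (rule F.normal_invI)
    show "subgroup acting_trivially F"
    proof (rule F.subgroupI)
      show "acting_trivially \<subseteq> carrier F"
        by (auto simp: acting_trivially_def intro: fp_class_in_carrier)
      show "acting_trivially \<noteq> {}"
        using cls_acting_trivially[of "[]"] by auto
    next
      fix A assume "A \<in> acting_trivially"
      then obtain x where x: "A = cls x" "x \<in> lists (letters V G)"
        "\<And>w. reduced w \<Longrightarrow> act_word x w \<sim>\<^sub>s w"
        unfolding acting_trivially_def by blast
      obtain y where y: "y \<in> lists (letters V G)" "inv\<^bsub>F\<^esub> A = cls y"
        "\<And>w. reduced w \<Longrightarrow> act_word y (act_word x w) \<sim>\<^sub>s w"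
        using inv_cls[OF x(2)] x(1) by metis
      have "act_word y w \<sim>\<^sub>s w" if "reduced w" for w
        using act_word_swap_equiv[OF swap_equiv_sym[OF x(3)[OF that]], of y] y(3)[OF that] by simp
      then show "inv\<^bsub>F\<^esub> A \<in> acting_trivially" using y cls_acting_trivially by simp
    next
      fix A B assume "A \<in> acting_trivially" "B \<in> acting_trivially"
      then obtain x y where x: "A = cls x" "x \<in> lists (letters V G)"
        "\<And>w. reduced w \<Longrightarrow> act_word x w \<sim>\<^sub>s w"
        and y: "B = cls y" "y \<in> lists (letters V G)"
        "\<And>w. reduced w \<Longrightarrow> act_word y w \<sim>\<^sub>s w"
        unfolding acting_trivially_def by blast
      have "act_word (x @ y) w \<sim>\<^sub>s w" if "reduced w" for w
        using act_word_swap_equiv[OF y(3)[OF that], of x] x(3)[OF that] by simp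
      then show "A \<otimes>\<^bsub>F\<^esub> B \<in> acting_trivially"
        using x y by (simp add: fp_mult_class cls_acting_trivially)
    qed
  next
    fix C A assume "C \<in> carrier F" "A \<in> acting_trivially"
    then obtain z x where z: "C = cls z" "z \<in> lists (letters V G)"
      and x: "A = cls x" "x \<in> lists (letters V G)"
        "\<And>w. reduced w \<Longrightarrow> act_word x w \<sim>\<^sub>s w"
      unfolding acting_trivially_def by (blast elim: fp_carrierE)
    obtain y where y: "y \<in> lists (letters V G)" "inv\<^bsub>F\<^esub> C = cls y"
      "\<And>w. reduced w \<Longrightarrow> act_word z (act_word y w) \<sim>\<^sub>s w"
      using inv_cls[OF z(2)] z(1) by metis
    have "act_word (z @ x @ y) w \<sim>\<^sub>s w" if "reduced w" for w
      using act_word_swap_equiv[OF x(3)[OF reduced_act_word[OF y(1) that]], of z] y(3)[OF that]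
      by simp
    then show "C \<otimes>\<^bsub>F\<^esub> A \<otimes>\<^bsub>F\<^esub> inv\<^bsub>F\<^esub> C \<in> acting_trivially"
      using x y z by (simp add: fp_mult_class cls_acting_trivially)
  qed
qed

lemma edge_commutators_act_trivially: "edge_commutators V E G \<subseteq> acting_trivially"
proof
  fix c assume "c \<in> edge_commutators V E G"
  then obtain u v g h where e: "{u, v} \<in> E" "u \<in> V" "v \<in> V"
    and g: "g \<in> carrier (G u)" and h: "h \<in> carrier (G v)"
    and c: "c = cls [(u, g)] \<otimes>\<^bsub>F\<^esub> cls [(v, h)] \<otimes>\<^bsub>F\<^esub> inv\<^bsub>F\<^esub> cls [(u, g)] \<otimes>\<^bsub>F\<^esub> inv\<^bsub>F\<^esub> cls [(v, h)]"
    unfolding edge_commutators_def vertex_group_def vertex_embedding_def by blast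
  have l: "[(u, g)] \<in> lists (letters V G)" "[(v, h)] \<in> lists (letters V G)"
    using e g h by (auto simp: letters_def)
  obtain x where x: "x \<in> lists (letters V G)" "inv\<^bsub>F\<^esub> cls [(u, g)] = cls x"
    "\<And>w. reduced w \<Longrightarrow> act_word [(u, g)] (act_word x w) \<sim>\<^sub>s w"
    using inv_cls[OF l(1)] by metis
  obtain y where y: "y \<in> lists (letters V G)" "inv\<^bsub>F\<^esub> cls [(v, h)] = cls y"
    "\<And>w. reduced w \<Longrightarrow> act_word [(v, h)] (act_word y w) \<sim>\<^sub>s w"
    using inv_cls[OF l(2)] by metis
  have "act_word ((([(u, g)] @ [(v, h)]) @ x) @ y) w \<sim>\<^sub>s w" if w: "reduced w" for w
  proof -
    have "act_word ((([(u, g)] @ [(v, h)]) @ x) @ y) w \<sim>\<^sub>s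
        act v h (act u g (act_word x (act_word y w)))"
      using act_commute[OF e(1)] by simp
    also have "\<dots> \<sim>\<^sub>s act v h (act_word y w)"
      using x(3)[OF reduced_act_word[OF y(1) w]] by (auto intro: act_swap_equiv)
    also have "\<dots> \<sim>\<^sub>s w"
      using y(3)[OF w] by simp
    finally show ?thesis .
  qed
  then have "cls ((([(u, g)] @ [(v, h)]) @ x) @ y) \<in> acting_trivially"
    using cls_acting_trivially l x(1) y(1) by (metis append_in_lists_conv)
  then show "c \<in> acting_trivially"
    using c x(1,2) y(1,2) l by (metis fp_mult_class append_in_lists_conv)
qed

lemma kernel_acts_trivially: "graph_product_kernel V E G \<subseteq> acting_trivially"
  unfolding graph_product_kernel_def normal_closure_def
  using acting_trivially_normal edge_commutators_act_trivially by blast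

lemma kernel_normal: "graph_product_kernel V E G \<lhd> F"
  unfolding graph_product_kernel_def
  by (intro group.normal_normal_closure[OF group_F] edge_commutators_closed groups)

section \<open>Reduced words in the graph product\<close>

abbreviation syllable :: "'v \<times> 'g \<Rightarrow> ('v \<times> 'g) list set" where
  "syllable \<equiv> \<lambda>(u, g). vertex_embedding V G u g"

lemma word_value_map_syllable:
  assumes "x \<in> lists (letters V G)"
  shows "word_value V E G (map syllable x) = graph_product_kernel V E G #>\<^bsub>F\<^esub> cls x"
  using assms
proof (induction x)
  case Nil
  interpret F: group F by (rule group_F)
  interpret K: normal "graph_product_kernel V E G" F by (rule kernel_normal)
  show ?case
    by (simp add: word_value_def graph_product_def FactGroup_def fp_one[symmetric]
        F.coset_mult_one[OF K.subset])
next
  case (Cons a x)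
  obtain u g where a: "a = (u, g)" by (cases a)
  have l: "[(u, g)] \<in> lists (letters V G)" "x \<in> lists (letters V G)" using Cons a by auto
  have syl: "syllable a = cls [(u, g)]" using a by (simp add: vertex_embedding_def)
  have IH: "word_value V E G (map syllable x) = graph_product_kernel V E G #>\<^bsub>F\<^esub> cls x"
    using Cons by simp
  have "word_value V E G (map syllable (a # x)) =
      (graph_product_kernel V E G #>\<^bsub>F\<^esub> syllable a) <#>\<^bsub>F\<^esub> word_value V E G (map syllable x)"
    by (simp add: word_value_def graph_product_def FactGroup_def)
  also have "\<dots> = (graph_product_kernel V E G #>\<^bsub>F\<^esub> cls [(u, g)]) <#>\<^bsub>F\<^esub> (graph_product_kernel V E G #>\<^bsub>F\<^esub> cls x)"
    by (simp only: syl IH)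
  also have "\<dots> = graph_product_kernel V E G #>\<^bsub>F\<^esub> (cls [(u, g)] \<otimes>\<^bsub>F\<^esub> cls x)"
    using normal.rcos_sum[OF kernel_normal] fp_class_in_carrier l by metis
  finally show ?case using a l by (simp add: fp_mult_class)
qed

text \<open>
  An element \<open>k\<close> of the kernel with \<open>x = k y\<close> acts trivially, so \<open>x\<close> and \<open>y\<close> send the empty word to
  equivalent words, and these are \<open>x\<close> and \<open>y\<close> themselves.
\<close>

theorem reduced_unique:
  assumes "reduced x" "reduced y"
    and "graph_product_kernel V E G #>\<^bsub>F\<^esub> cls x = graph_product_kernel V E G #>\<^bsub>F\<^esub> cls y"
  shows "x \<sim>\<^sub>s y"
proof -
  interpret F: group F by (rule group_F)
  interpret K: normal "graph_product_kernel V E G" F by (rule kernel_normal)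
  have l: "x \<in> lists (letters V G)" "y \<in> lists (letters V G)"
    using assms reduced_letters by auto
  have "cls x \<in> graph_product_kernel V E G #>\<^bsub>F\<^esub> cls y"
    using assms(3) F.rcos_self[OF fp_class_in_carrier[OF l(1)] K.subgroup_axioms] by simp
  then obtain k where k: "k \<in> graph_product_kernel V E G" "cls x = k \<otimes>\<^bsub>F\<^esub> cls y"
    by (auto simp: r_coset_def)
  then have "k \<in> acting_trivially" using kernel_acts_trivially by blast
  then obtain z where z: "k = cls z" "z \<in> lists (letters V G)"
    "\<And>w. reduced w \<Longrightarrow> act_word z w \<sim>\<^sub>s w"
    unfolding acting_trivially_def by blast
  have "cls x = cls (z @ y)" using k z l by (simp add: fp_mult_class)
  then have "act_word x [] \<sim>\<^sub>s act_word (z @ y) []"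
    by (rule act_word_cls_eq) (use l z in auto)
  then have "x \<sim>\<^sub>s act_word z y" using assms by (simp add: act_word_Nil)
  also have "\<dots> \<sim>\<^sub>s y" using z assms by blast
  finally show ?thesis .
qed

section \<open>From syllables to letters\<close>

lemma vertex_embedding_one: "u \<in> V \<Longrightarrow> vertex_embedding V G u \<one>\<^bsub>G u\<^esub> = \<one>\<^bsub>F\<^esub>"
  by (rule hom_one[OF vertex_embedding_hom]) (auto intro: groups group_F)

lemma front_neq_oneD:
  assumes "front u x \<noteq> \<one>\<^bsub>G u\<^esub>"
  shows "\<exists>j<length x. fst (x ! j) = u \<and> (\<forall>k<j. {u, fst (x ! k)} \<in> E)"
  using assms
proof (induction x rule: reduced.induct)
  case (2 v g x)
  show ?case
  proof (cases "v = u")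
    case False
    then have e: "{u, v} \<in> E" using 2 by (auto split: if_splits)
    then obtain j where "j < length x" "fst (x ! j) = u" "\<forall>k<j. {u, fst (x ! k)} \<in> E"
      using 2 False by auto
    then show ?thesis using e by (intro exI[of _ "Suc j"]) (auto simp: less_Suc_eq_0_disj)
  qed auto
qed simp

text \<open>
  Connects the recursive notion of reducedness with the formulation by positions: a nontrivial front
  at \<open>u\<close> would be a later letter over \<open>u\<close> that is separated by neighbours of \<open>u\<close> only.
\<close>

lemma reducedI:
  assumes "x \<in> lists (letters V G)"
    and "\<And>u g. (u, g) \<in> set x \<Longrightarrow> g \<noteq> \<one>\<^bsub>G u\<^esub>"
    and "\<And>i j. \<lbrakk>i < j; j < length x; fst (x ! i) = fst (x ! j)\<rbrakk>
      \<Longrightarrow> \<exists>k. i < k \<and> k < j \<and> {fst (x ! i), fst (x ! k)} \<notin> E"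
  shows "reduced x"
  using assms
proof (induction x rule: reduced.induct)
  case (2 u g x)
  have "front u x = \<one>\<^bsub>G u\<^esub>"
  proof (rule ccontr)
    assume "front u x \<noteq> \<one>\<^bsub>G u\<^esub>"
    then obtain j where j: "j < length x" "fst (x ! j) = u" "\<forall>k<j. {u, fst (x ! k)} \<in> E"
      using front_neq_oneD by blast
    then show False using "2.prems"(3)[of 0 "Suc j"] by (auto simp: gr0_conv_Suc)
  qed
  moreover have "reduced x"
  proof (rule "2.IH")
    fix i j assume "i < j" "j < length x" "fst (x ! i) = fst (x ! j)"
    then obtain k where "Suc i < k" "k < Suc j" "{fst (x ! i), fst (((u, g) # x) ! k)} \<notin> E"
      using "2.prems"(3)[of "Suc i" "Suc j"] by auto
    then show "\<exists>k. i < k \<and> k < j \<and> {fst (x ! i), fst (x ! k)} \<notin> E"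
      by (intro exI[of _ "k - 1"]) (auto simp: nth_Cons')
  qed (use 2 in auto)
  ultimately show ?case using 2 by (auto simp: letters_def)
qed simp

text \<open>
  The definition of graphically reduced words speaks of the vertex-groups that contain a syllable, the recursive notion of the
  vertex of a letter. For any encoding by letters, a syllable belongs to the vertex-group of its
  letter; so if no vertex-group adjacent to \<open>u\<close> contains the syllable at \<open>k\<close>, then the letter at
  \<open>k\<close> does not lie over a neighbour of \<open>u\<close> either, and this is the direction that is needed.
\<close>

lemma graphically_reduced_cases:
  assumes "graphically_reduced V E G w"
  obtains "w = [\<one>\<^bsub>F\<^esub>]"
  | x where "reduced x" "x \<noteq> []" "w = map syllable x"
proof (cases "w = [\<one>\<^bsub>F\<^esub>]")
  case False
  have nontriv: "\<forall>i<length w. w ! i \<noteq> \<one>\<^bsub>F\<^esub>" and ne: "w \<noteq> []"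
    using assms False unfolding graphically_reduced_def
    by (auto simp: length_Suc_conv)
  have "w \<in> lists (\<Union>u\<in>V. vertex_group V G u)"
    using assms unfolding graphically_reduced_def by blast
  then have "\<exists>x. x \<in> lists (letters V G) \<and> w = map syllable x"
  proof (induction w)
    case (Cons s w)
    then obtain x u g where "x \<in> lists (letters V G)" "w = map syllable x"
      "u \<in> V" "g \<in> carrier (G u)" "s = vertex_embedding V G u g"
      by (auto simp: vertex_group_def)
    then show ?case by (intro exI[of _ "(u, g) # x"]) (auto simp: letters_def)
  qed simp
  then obtain x where x: "x \<in> lists (letters V G)" "w = map syllable x" by blast
  have vertex: "fst (x ! i) \<in> V" "w ! i \<in> vertex_group V G (fst (x ! i))" if i: "i < length x" for i
  proof -
    obtain u g where ug: "x ! i = (u, g)" by (cases "x ! i")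
    have "x ! i \<in> letters V G" using x(1) nth_mem[OF i] by blast
    then show "fst (x ! i) \<in> V" "w ! i \<in> vertex_group V G (fst (x ! i))"
      using x(2) i ug by (auto simp: letters_def vertex_group_def)
  qed
  have "reduced x"
  proof (rule reducedI)
    fix u g assume "(u, g) \<in> set x"
    then obtain i where i: "i < length x" "x ! i = (u, g)" by (auto simp: in_set_conv_nth)
    then have "vertex_embedding V G u g \<noteq> \<one>\<^bsub>F\<^esub>" "u \<in> V"
      using nontriv x(2) vertex(1)[OF i(1)] by auto
    then show "g \<noteq> \<one>\<^bsub>G u\<^esub>" using vertex_embedding_one by blast
  next
    fix i j assume ij: "i < j" "j < length x" "fst (x ! i) = fst (x ! j)"
    then have "\<exists>k. i < k \<and> k < j \<and>
        \<not> (\<exists>v\<in>V. {fst (x ! i), v} \<in> E \<and> w ! k \<in> vertex_group V G v)"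
      using assms vertex[of i] vertex[of j] x(2) unfolding graphically_reduced_def by simp
    then show "\<exists>k. i < k \<and> k < j \<and> {fst (x ! i), fst (x ! k)} \<notin> E"
      using vertex ij(2) by (meson less_trans)
  qed (fact x)
  then show thesis using that(2) x ne by blast
qed (rule that(1))

text \<open>
  Exchanges of letters are defined for arbitrary group elements, exchanges of syllables only for
  members of the vertex-groups; this is why the word has to consist of proper letters.
\<close>

lemma map_syllable_swap:
  assumes "swap x y" "x \<in> lists (letters V G)"
  shows "syllable_swap V E G (map syllable x) (map syllable y)"
  using assms
proof (induction rule: swap.induct)
  case (here u v g h w)
  then have "syllable_swap V E G ([] @ [syllable (u, g), syllable (v, h)] @ map syllable w)
      ([] @ [syllable (v, h), syllable (u, g)] @ map syllable w)"
    by (intro syllable_swap.intros[of u V v]) (auto simp: letters_def vertex_group_def)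
  then show ?case by simp
next
  case (later w w' a)
  then have "syllable_swap V E G (map syllable w) (map syllable w')" by simp
  then show ?case
  proof cases
    case (1 u v s t xs ys)
    then show ?thesis
      using syllable_swap.intros[of u V v E s G t "syllable a # xs" ys] by simp
  qed
qed

lemma map_syllable_swap_equiv:
  assumes "x \<sim>\<^sub>s y" "reduced x"
  shows "(syllable_swap V E G)\<^sup>*\<^sup>* (map syllable x) (map syllable y)"
  using assms(1)
proof (induction rule: rtranclp_induct)
  case (step y z)
  then have "y \<in> lists (letters V G)"
    using reduced_swap_equiv reduced_letters assms(2) by blast
  then show ?case
    using step map_syllable_swap by (meson rtranclp.rtrancl_into_rtrancl)
qed simp

end

theorem theorem1p2:
  fixes V :: "'v set" and E :: "'v set set" and G :: "'v \<Rightarrow> ('g, 'm) monoid_scheme"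
    and w1 w2 :: "('v \<times> 'g) list set list"
  assumes "simplicial_graph V E"
    and "\<And>u. u \<in> V \<Longrightarrow> group (G u)"
    and "\<And>u. u \<in> V \<Longrightarrow> carrier (G u) \<noteq> {\<one>\<^bsub>G u\<^esub>}"
    and "graphically_reduced V E G w1" and "graphically_reduced V E G w2"
    and "word_value V E G w1 = word_value V E G w2"
  shows "(syllable_swap V E G)\<^sup>*\<^sup>* w1 w2"
proof -
  interpret graph_of_groups V E G by (rule graph_of_groups.intro) (fact assms)+
  \<comment> \<open>The syllable word \<open>1\<close> and the empty word of letters have the same value.\<close>
  have encode: "\<exists>x. reduced x \<and> w = (if x = [] then [\<one>\<^bsub>F\<^esub>] else map syllable x) \<and>
      word_value V E G w = graph_product_kernel V E G #>\<^bsub>F\<^esub> cls x"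
    if w: "graphically_reduced V E G w" for w
    using w
  proof (cases rule: graphically_reduced_cases)
    case 1
    interpret P: group "graph_product V E G" by (intro group_graph_product groups)
    have "word_value V E G w = (graph_product_kernel V E G #>\<^bsub>F\<^esub> cls []) \<otimes>\<^bsub>graph_product V E G\<^esub> \<one>\<^bsub>graph_product V E G\<^esub>"
      using 1 by (simp add: word_value_def fp_one)
    also have "graph_product_kernel V E G #>\<^bsub>F\<^esub> cls [] = \<one>\<^bsub>graph_product V E G\<^esub>"
      using word_value_map_syllable[of "[]"] by (simp add: word_value_def)
    finally show ?thesis
      using 1 word_value_map_syllable[of "[]"] by (intro exI[of _ "[]"]) (simp add: word_value_def)
  next
    case (2 x)
    then show ?thesis using word_value_map_syllable[OF reduced_letters[OF 2(1)]] by auto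
  qed
  from encode[OF assms(4)] obtain x where x: "reduced x"
    "w1 = (if x = [] then [\<one>\<^bsub>F\<^esub>] else map syllable x)"
    "word_value V E G w1 = graph_product_kernel V E G #>\<^bsub>F\<^esub> cls x"
    by blast
  from encode[OF assms(5)] obtain y where y: "reduced y"
    "w2 = (if y = [] then [\<one>\<^bsub>F\<^esub>] else map syllable y)"
    "word_value V E G w2 = graph_product_kernel V E G #>\<^bsub>F\<^esub> cls y"
    by blast
  have eq: "x \<sim>\<^sub>s y"
    by (rule reduced_unique[OF x(1) y(1)]) (simp only: x(3)[symmetric] y(3)[symmetric] assms(6))
  then have "x = [] \<longleftrightarrow> y = []"
    by (auto dest: swap_equiv_length)
  then show ?thesis
    using map_syllable_swap_equiv[OF eq x(1)] unfolding x(2) y(2) by simp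
qed

end
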